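(* Let $D$ be a loopless graph on $n$ vertices with set of sources $S$, and let $q \ge 2$ denote an integer. Then: (i) $\mathrm{s}[D^\circ, q] = n - \sigma(D)$ for all $q \ge n - |S|$; (ii) $\mathrm{i}[D^\circ, q] = n$ for all $q \ge 3$.
   Context: Graphs are finite and directed: $D=(V,E)$ with $V=\{1,\dots,n\}$, $n\ge 1$, $E\subseteq V^2$. A loop is an arc $(v,v)$; $D$ is loopless if it has no loops. For loopless $D$, $D^\circ$ is the graph obtained from $D$ by adding a loop on every vertex. The in-neighbourhood of $v$ in a graph $H$ is $N(v;H)=\{u : (u,v)\in E(H)\}$. A source of $D$ is a vertex with empty in-neighbourhood in $D$. With $S$ the set of sources of $D$, $$\sigma(D) := \max\{ |U| : U\subseteq V\setminus S,\ N(u;D^\circ)\cap N(v;D^\circ)=\emptyset \text{ for all } u,v\in U,\ u\neq v\}.$$ For an integer $q\ge 2$ let $[q]=\{0,\dots,q-1\}$. For $f=(f_1,\dots,f_n):[q]^n\to[q]^n$, the interaction graph $G(f)$ has vertex set $V$ and an arc $(u,v)$ if and only if there exist $x,y\in[q]^n$ differing only in coordinate $u$ with $f_v(x)\ne f_v(y)$. For a graph $H$ on $V$, $\mathrm{F}[H,q]$ is the set of all $f:[q]^n\to[q]^n$ with $G(f)=H$. Let $d_{\mathrm H}$ be the Hamming distance, $\mathrm{s}(f)=\min_{x\in[q]^n}(n-d_{\mathrm H}(x,f(x)))$ and $\mathrm{i}(f)=\min_{x\in[q]^n}d_{\mathrm H}(x,f(x))$. Finally $\mathrm{s}[H,q]=\max_{f\in\mathrm{F}[H,q]}\mathrm{s}(f)$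 and $\mathrm{i}[H,q]=\max_{f\in\mathrm{F}[H,q]}\mathrm{i}(f)$. *)

theory Defs
  imports "Graph_Theory.Pair_Digraph" "HOL-Library.FuncSet"
begin

definition in_nbh :: "'a pair_pre_digraph \<Rightarrow> 'a \<Rightarrow> 'a set" where
  "in_nbh H v = {u. (u, v) \<in> parcs H}"

definition sources :: "'a pair_pre_digraph \<Rightarrow> 'a set" where
  "sources D = {v \<in> pverts D. in_nbh D v = {}}"

definition add_loops :: "'a pair_pre_digraph \<Rightarrow> 'a pair_pre_digraph" where
  "add_loops D = \<lparr>pverts = pverts D, parcs = parcs D \<union> {(v, v) | v. v \<in> pverts D}\<rparr>"

definition sigma :: "'a pair_pre_digraph \<Rightarrow> nat" where
  "sigma D = Max {card U | U. U \<subseteq> pverts D - sources D \<and>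
     (\<forall>u\<in>U. \<forall>v\<in>U. u \<noteq> v \<longrightarrow> in_nbh (add_loops D) u \<inter> in_nbh (add_loops D) v = {})}"

text \<open>A configuration is an extensional function on \<open>{1..n}\<close> (\<open>undefined\<close> outside), so that
  equality of configurations is equality of tuples; likewise for the maps between them.\<close>

definition configs :: "nat \<Rightarrow> nat \<Rightarrow> (nat \<Rightarrow> nat) set" where
  "configs n q = {1..n} \<rightarrow>\<^sub>E {0..<q}"

definition interaction_graph ::
    "nat \<Rightarrow> nat \<Rightarrow> ((nat \<Rightarrow> nat) \<Rightarrow> (nat \<Rightarrow> nat)) \<Rightarrow> nat pair_pre_digraph" where
  "interaction_graph n q f = \<lparr>pverts = {1..n},
     parcs = {(u, v). u \<in> {1..n} \<and> v \<in> {1..n} \<and>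
       (\<exists>x\<in>configs n q. \<exists>y\<in>configs n q. {i \<in> {1..n}. x i \<noteq> y i} = {u} \<and> f x v \<noteq> f y v)}\<rparr>"

definition networks ::
    "nat \<Rightarrow> nat pair_pre_digraph \<Rightarrow> nat \<Rightarrow> ((nat \<Rightarrow> nat) \<Rightarrow> (nat \<Rightarrow> nat)) set" where
  "networks n H q = {f \<in> configs n q \<rightarrow>\<^sub>E configs n q. interaction_graph n q f = H}"

definition hamming_dist :: "nat \<Rightarrow> (nat \<Rightarrow> nat) \<Rightarrow> (nat \<Rightarrow> nat) \<Rightarrow> nat" where
  "hamming_dist n x y = card {i \<in> {1..n}. x i \<noteq> y i}"

definition stability :: "nat \<Rightarrow> nat \<Rightarrow> ((nat \<Rightarrow> nat) \<Rightarrow> (nat \<Rightarrow> nat)) \<Rightarrow> nat" where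
  "stability n q f = Min ((\<lambda>x. n - hamming_dist n x (f x)) ` configs n q)"

definition instability :: "nat \<Rightarrow> nat \<Rightarrow> ((nat \<Rightarrow> nat) \<Rightarrow> (nat \<Rightarrow> nat)) \<Rightarrow> nat" where
  "instability n q f = Min ((\<lambda>x. hamming_dist n x (f x)) ` configs n q)"

text \<open>The maxima below range over finite sets, but are meaningful only if \<open>networks n H q\<close> is
  nonempty: \<open>Max {}\<close> is unspecified.\<close>

definition max_stability :: "nat \<Rightarrow> nat pair_pre_digraph \<Rightarrow> nat \<Rightarrow> nat" where
  "max_stability n H q = Max (stability n q ` networks n H q)"

definition max_instability :: "nat \<Rightarrow> nat pair_pre_digraph \<Rightarrow> nat \<Rightarrow> nat" where
  "max_instability n H q = Max (instability n q ` networks n H q)"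

end

theory Submission
  imports Defs
begin

text \<open>If \<open>f\<close> has interaction graph \<open>D\<^sup>\<circ>\<close> and \<open>u\<close> has an in-neighbour \<open>w \<noteq> u\<close>, two configurations
  witnessing the arc \<open>(w, u)\<close> agree at \<open>u\<close>, so one of them is moved by \<open>f\<close> at \<open>u\<close>; since \<open>f\<^sub>u\<close> only
  reads the in-neighbourhood of \<open>u\<close>, such configurations can be glued along pairwise disjoint
  in-neighbourhoods, which gives \<open>s(f) \<le> n - \<sigma>(D)\<close>. For the converse give the non-sources distinct
  colours and let \<open>f\<close> move \<open>v\<close> only when the whole in-neighbourhood of \<open>v\<close> has the colour of \<open>v\<close>:
  vertices moved simultaneously then have disjoint in-neighbourhoods. For instability,
  add \<open>1\<close> or \<open>2\<close> modulo \<open>q\<close> to \<open>x\<^sub>v\<close>, the choice depending on the other in-neighbours.\<close>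

section \<open>Configurations\<close>

lemma finite_configs: "finite (configs n q)"
  by (simp add: configs_def finite_PiE)

lemma configs_nonempty:
  assumes "q > 0"
  shows "configs n q \<noteq> {}"
  using assms by (auto simp: configs_def PiE_eq_empty_iff)

lemma finite_networks: "finite (networks n H q)"
  by (rule finite_subset[of _ "configs n q \<rightarrow>\<^sub>E configs n q"])
    (auto simp: networks_def intro: finite_PiE finite_configs)

lemma restrict_in_configs:
  assumes "\<And>i. i \<in> {1..n} \<Longrightarrow> h i < q"
  shows "restrict h {1..n} \<in> configs n q"
  using assms by (auto simp: configs_def)

lemma fun_upd_in_configs:
  assumes "x \<in> configs n q" "i \<in> {1..n}" "a < q"
  shows "x(i := a) \<in> configs n q"
  using assms by (auto simp: configs_def PiE_iff extensional_def)

lemma configs_less: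
  assumes "x \<in> configs n q" "i \<in> {1..n}"
  shows "x i < q"
  using assms by (auto simp: configs_def PiE_iff)

section \<open>Interaction graphs and local dependence\<close>

lemma networks_arc_iff:
  assumes "f \<in> networks n H q"
  shows "(u, v) \<in> parcs H \<longleftrightarrow> u \<in> {1..n} \<and> v \<in> {1..n} \<and>
    (\<exists>x\<in>configs n q. \<exists>y\<in>configs n q. {i \<in> {1..n}. x i \<noteq> y i} = {u} \<and> f x v \<noteq> f y v)"
proof -
  have "H = interaction_graph n q f"
    using assms by (simp add: networks_def)
  then show ?thesis
    unfolding interaction_graph_def by simp
qed

text \<open>Turn \<open>x\<close> into \<open>y\<close> one coordinate at a time. A step that
  changes the value at \<open>v\<close> would exhibit an arc into \<open>v\<close> from the changed
  coordinate, but on the in-neighbourhood nothing has to be changed.\<close>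

lemma networks_local:
  assumes f: "f \<in> networks n H q" and v: "v \<in> {1..n}"
    and x: "x \<in> configs n q" and y: "y \<in> configs n q"
    and agree: "\<And>w. w \<in> in_nbh H v \<Longrightarrow> x w = y w"
  shows "f x v = f y v"
proof -
  have "f (override_on x y A) v = f x v \<and> override_on x y A \<in> configs n q"
    if "finite A" "A \<subseteq> {1..n}" for A
    using that
  proof (induction A rule: finite_induct)
    case empty
    then show ?case using x by simp
  next
    case (insert a A)
    let ?z = "override_on x y A"
    have z: "f ?z v = f x v" "?z \<in> configs n q" and a: "a \<in> {1..n}"
      using insert by auto
    have upd: "override_on x y (insert a A) = ?z(a := y a)"
      by (simp add: override_on_insert)
    have z': "?z(a := y a) \<in> configs n q"
      using z(2) a configs_less[OF y a] by (rule fun_upd_in_configs)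
    have "f (?z(a := y a)) v = f ?z v"
    proof (cases "x a = y a")
      case True
      then have "?z(a := y a) = ?z"
        using insert.hyps by (auto simp: override_on_def)
      then show ?thesis by simp
    next
      case False
      then have "(a, v) \<notin> parcs H"
        using agree[of a] by (auto simp: in_nbh_def)
      moreover have "{i \<in> {1..n}. (?z(a := y a)) i \<noteq> ?z i} = {a}"
        using False insert.hyps a by (auto simp: override_on_def)
      ultimately show ?thesis
        using networks_arc_iff[OF f, of a v] z(2) z' a v by blast
    qed
    then show ?case unfolding upd using z(1) z' by metis
  qed
  from this[of "{1..n}"] have "f (override_on x y {1..n}) v = f x v" by simp
  \<comment> \<open>Outside \<open>{1..n}\<close> both configurations are \<open>undefined\<close>,
    so overriding on \<open>{1..n}\<close> yields \<open>y\<close> itself.\<close>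
  moreover have "override_on x y {1..n} = y"
    using x y by (auto simp: override_on_def configs_def PiE_iff extensional_def)
  ultimately show ?thesis by simp
qed

text \<open>Locality of \<open>g\<close> excludes arcs outside \<open>H\<close>, and
  \<open>dep\<close> realises every arc of \<open>H\<close>. Asking in \<open>dep\<close> for a
  single update \<open>x(u := a)\<close> leaves only one configuration and one state to be exhibited
  per arc.\<close>

lemma network_of_local_functions:
  assumes H: "pverts H = {1..n}" "parcs H \<subseteq> {1..n} \<times> {1..n}"
    and bound: "\<And>v x. v \<in> {1..n} \<Longrightarrow> x \<in> configs n q \<Longrightarrow> g v x < q"
    and local: "\<And>v x y. v \<in> {1..n} \<Longrightarrow> (\<And>w. w \<in> in_nbh H v \<Longrightarrow> x w = y w) \<Longrightarrow> g v x = g v y"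
    and dep: "\<And>u v. (u, v) \<in> parcs H \<Longrightarrow> \<exists>x\<in>configs n q. \<exists>a<q. g v (x(u := a)) \<noteq> g v x"
  shows "(\<lambda>x\<in>configs n q. \<lambda>v\<in>{1..n}. g v x) \<in> networks n H q"
proof -
  let ?f = "\<lambda>x\<in>configs n q. \<lambda>v\<in>{1..n}. g v x"
  have "?f \<in> configs n q \<rightarrow>\<^sub>E configs n q"
    using bound by (simp only: restrict_PiE_iff) (blast intro: restrict_in_configs)
  moreover have "interaction_graph n q ?f = H"
  proof -
    have "(u \<in> {1..n} \<and> v \<in> {1..n} \<and> (\<exists>x\<in>configs n q. \<exists>y\<in>configs n q.
        {i \<in> {1..n}. x i \<noteq> y i} = {u} \<and> ?f x v \<noteq> ?f y v)) \<longleftrightarrow> (u, v) \<in> parcs H" for u v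
    proof
      assume L: "u \<in> {1..n} \<and> v \<in> {1..n} \<and> (\<exists>x\<in>configs n q. \<exists>y\<in>configs n q.
        {i \<in> {1..n}. x i \<noteq> y i} = {u} \<and> ?f x v \<noteq> ?f y v)"
      then obtain x y where xy: "{i \<in> {1..n}. x i \<noteq> y i} = {u}" "g v x \<noteq> g v y" and v: "v \<in> {1..n}"
        by auto
      \<comment> \<open>Contrapositive of locality: some in-neighbour distinguishes \<open>x\<close>
        from \<open>y\<close>, and \<open>u\<close> is the only vertex that can.\<close>
      from xy(2) local[OF v, of x y] obtain w where w: "(w, v) \<in> parcs H" "x w \<noteq> y w"
        by (auto simp: in_nbh_def)
      with H(2) have "w \<in> {1..n}" by auto
      with w xy(1) have "w = u" by auto
      with w show "(u, v) \<in> parcs H" by simp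
    next
      assume R: "(u, v) \<in> parcs H"
      then obtain x a where x: "x \<in> configs n q" "a < q" "g v (x(u := a)) \<noteq> g v x"
        using dep by blast
      have uv: "u \<in> {1..n}" "v \<in> {1..n}" using R H(2) by auto
      have x': "x(u := a) \<in> configs n q"
        using x(1) uv(1) x(2) by (rule fun_upd_in_configs)
      have "a \<noteq> x u" using x(3) by auto
      then have "{i \<in> {1..n}. (x(u := a)) i \<noteq> x i} = {u}" using uv by auto
      moreover have "?f (x(u := a)) v \<noteq> ?f x v" using x x' uv by simp
      ultimately show "u \<in> {1..n} \<and> v \<in> {1..n} \<and> (\<exists>x\<in>configs n q. \<exists>y\<in>configs n q.
        {i \<in> {1..n}. x i \<noteq> y i} = {u} \<and> ?f x v \<noteq> ?f y v)"
        using uv x(1) x' by blast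
    qed
    then have "interaction_graph n q ?f = \<lparr>pverts = pverts H, parcs = {(u, v). (u, v) \<in> parcs H}\<rparr>"
      unfolding interaction_graph_def H(1) by presburger
    then show ?thesis by simp
  qed
  ultimately show ?thesis by (simp add: networks_def)
qed

section \<open>Bounds on stability and instability\<close>

lemma stability_le:
  assumes "x \<in> configs n q"
  shows "stability n q f \<le> n - hamming_dist n x (f x)"
  unfolding stability_def using assms by (intro Min_le) (auto simp: finite_configs)

lemma stability_ge:
  assumes "q > 0" "\<And>x. x \<in> configs n q \<Longrightarrow> hamming_dist n x (f x) \<le> k"
  shows "n - k \<le> stability n q f"
  unfolding stability_def
  using assms finite_configs configs_nonempty by (subst Min_ge_iff) (auto intro: diff_le_mono2)

lemma hamming_dist_le: "hamming_dist n x y \<le> n"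
proof -
  have "hamming_dist n x y \<le> card {1..n}"
    unfolding hamming_dist_def by (rule card_mono) auto
  then show ?thesis by simp
qed

lemma instability_le:
  assumes "q > 0"
  shows "instability n q f \<le> n"
proof -
  obtain x where x: "x \<in> configs n q" using configs_nonempty[OF assms] by blast
  have "instability n q f \<le> hamming_dist n x (f x)"
    unfolding instability_def using x by (intro Min_le) (auto simp: finite_configs)
  then show ?thesis using hamming_dist_le order_trans by blast
qed

lemma instability_eq:
  assumes "q > 0" "\<And>x v. x \<in> configs n q \<Longrightarrow> v \<in> {1..n} \<Longrightarrow> f x v \<noteq> x v"
  shows "instability n q f = n"
proof -
  have "hamming_dist n x (f x) = n" if "x \<in> configs n q" for x
  proof -
    have "{i \<in> {1..n}. x i \<noteq> f x i} = {1..n}" using assms(2)[OF that] by force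
    then show ?thesis by (simp add: hamming_dist_def)
  qed
  then have "(\<lambda>x. hamming_dist n x (f x)) ` configs n q = {n}"
    using configs_nonempty[OF assms(1)] by force
  then show ?thesis by (simp add: instability_def)
qed

section \<open>Packings of in-neighbourhoods, the sets over which \<open>sigma\<close> is a
  maximum\<close>

definition packing :: "'a pair_pre_digraph \<Rightarrow> 'a set \<Rightarrow> bool" where
  "packing D U \<longleftrightarrow> U \<subseteq> pverts D - sources D \<and>
     (\<forall>u\<in>U. \<forall>v\<in>U. u \<noteq> v \<longrightarrow> in_nbh (add_loops D) u \<inter> in_nbh (add_loops D) v = {})"

lemma sigma_packing: "sigma D = Max (card ` {U. packing D U})"
  unfolding sigma_def packing_def by (rule arg_cong[of _ _ Max]) auto

lemma finite_packings:
  assumes "finite (pverts D)"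
  shows "finite {U. packing D U}"
  by (rule finite_subset[of _ "Pow (pverts D)"]) (use assms in \<open>auto simp: packing_def\<close>)

lemma card_packing_le_sigma:
  assumes "finite (pverts D)" "packing D U"
  shows "card U \<le> sigma D"
  unfolding sigma_packing using assms finite_packings by (intro Max_ge) auto

lemma sigma_attained:
  assumes "finite (pverts D)"
  obtains U where "packing D U" "card U = sigma D"
proof -
  \<comment> \<open>The empty packing ensures that the maximum is over a nonempty family.\<close>
  have "packing D {}" by (simp add: packing_def)
  then have "sigma D \<in> card ` {U. packing D U}"
    unfolding sigma_packing using finite_packings[OF assms] by (intro Max_in) auto
  then show ?thesis using that by auto
qed

lemma in_nbh_add_loops:
  assumes "v \<in> pverts D"
  shows "in_nbh (add_loops D) v = insert v (in_nbh D v)"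
  using assms by (auto simp: in_nbh_def add_loops_def)

lemma add_loops_arc_iff: "(u, v) \<in> parcs (add_loops D) \<longleftrightarrow> (u, v) \<in> parcs D \<or> u = v \<and> v \<in> pverts D"
  by (auto simp: add_loops_def)

section \<open>Networks on a loopless graph with all loops added\<close>

context
  fixes n :: nat and D :: "nat pair_pre_digraph"
  assumes verts: "pverts D = {1..n}" and loopfree: "pair_loopfree_digraph D"
begin

lemma arc_verts:
  assumes "(u, v) \<in> parcs D"
  shows "u \<in> {1..n}" "v \<in> {1..n}" "u \<noteq> v"
proof -
  interpret pair_loopfree_digraph D by (rule loopfree)
  show "u \<in> {1..n}" "v \<in> {1..n}" "u \<noteq> v"
    using in_arcsD1[OF assms] in_arcsD2[OF assms] no_loops[OF assms] verts by auto
qed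

lemma not_source_in_neighbour:
  assumes "v \<in> {1..n}" "v \<notin> sources D"
  obtains w where "(w, v) \<in> parcs D"
  using assms verts by (auto simp: sources_def in_nbh_def)

text \<open>Separates the added loops from the arcs of \<open>D\<close>, because the constructions
  below use different witnesses for the two kinds.\<close>

lemma network_add_loops:
  assumes bound: "\<And>v x. v \<in> {1..n} \<Longrightarrow> x \<in> configs n q \<Longrightarrow> g v x < q"
    and local: "\<And>v x y. v \<in> {1..n} \<Longrightarrow> x v = y v \<Longrightarrow> (\<And>w. (w, v) \<in> parcs D \<Longrightarrow> x w = y w)
      \<Longrightarrow> g v x = g v y"
    and dep_self: "\<And>v. v \<in> {1..n} \<Longrightarrow> \<exists>x\<in>configs n q. \<exists>a<q. g v (x(v := a)) \<noteq> g v x"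
    and dep_arc: "\<And>u v. (u, v) \<in> parcs D \<Longrightarrow> \<exists>x\<in>configs n q. \<exists>a<q. g v (x(u := a)) \<noteq> g v x"
  shows "(\<lambda>x\<in>configs n q. \<lambda>v\<in>{1..n}. g v x) \<in> networks n (add_loops D) q"
proof (rule network_of_local_functions)
  show "pverts (add_loops D) = {1..n}" using verts by (simp add: add_loops_def)
  show "parcs (add_loops D) \<subseteq> {1..n} \<times> {1..n}"
    using arc_verts verts by (auto simp: add_loops_def)
  show "g v x = g v y" if "v \<in> {1..n}" "\<And>w. w \<in> in_nbh (add_loops D) v \<Longrightarrow> x w = y w" for v x y
    using local[of v x y] that verts by (auto simp: in_nbh_def add_loops_arc_iff)
  show "\<exists>x\<in>configs n q. \<exists>a<q. g v (x(u := a)) \<noteq> g v x" if "(u, v) \<in> parcs (add_loops D)" for u v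
    using that dep_self dep_arc verts by (auto simp: add_loops_arc_iff)
qed (use bound in auto)

section \<open>Upper bound for the stability\<close>

lemma network_moves_non_source:
  assumes f: "f \<in> networks n (add_loops D) q" and u: "u \<in> {1..n}" "u \<notin> sources D"
  obtains z where "z \<in> configs n q" "f z u \<noteq> z u"
proof -
  obtain w where w: "(w, u) \<in> parcs D" using not_source_in_neighbour[OF u] .
  then have "(w, u) \<in> parcs (add_loops D)" by (simp add: add_loops_arc_iff)
  then obtain x y where xy: "x \<in> configs n q" "y \<in> configs n q"
    "{i \<in> {1..n}. x i \<noteq> y i} = {w}" "f x u \<noteq> f y u"
    using networks_arc_iff[OF f, of w u] by blast
  \<comment> \<open>Looplessness gives \<open>w \<noteq> u\<close>. As the images of
    \<open>x\<close> and \<open>y\<close> differ at \<open>u\<close>, they cannot both equal this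
    common state.\<close>
  have "x u = y u" using xy(3) arc_verts[OF w] by auto
  then show ?thesis using xy that[of x] that[of y] by metis
qed

lemma stability_upper_bound:
  assumes f: "f \<in> networks n (add_loops D) q" and q: "q > 0"
  shows "stability n q f \<le> n - sigma D"
proof -
  let ?N = "in_nbh (add_loops D)"
  obtain U where U: "packing D U" "card U = sigma D"
    using sigma_attained[of D] verts by auto
  have U_sub: "U \<subseteq> {1..n}" "U \<inter> sources D = {}"
    using U(1) verts by (auto simp: packing_def)
  have "\<exists>z. z \<in> configs n q \<and> f z u \<noteq> z u" if "u \<in> U" for u
    using network_moves_non_source[OF f, of u] that U_sub by blast
  then obtain z where z: "\<And>u. u \<in> U \<Longrightarrow> z u \<in> configs n q" "\<And>u. u \<in> U \<Longrightarrow> f (z u) u \<noteq> z u u"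
    by metis
  \<comment> \<open>The description is well defined because the sets \<open>?N u\<close> are
    pairwise disjoint. Off their union any state would do; \<open>0\<close> is one since
    \<open>q > 0\<close>.\<close>
  define h where "h w = (if \<exists>u\<in>U. w \<in> ?N u then z (THE u. u \<in> U \<and> w \<in> ?N u) w else 0)" for w
  have h: "h w = z u w" if "u \<in> U" "w \<in> ?N u" for u w
  proof -
    have "(THE u. u \<in> U \<and> w \<in> ?N u) = u"
      using that U(1) by (intro the_equality) (auto simp: packing_def)
    then show ?thesis using that by (auto simp: h_def)
  qed
  define x where "x = restrict h {1..n}"
  have x: "x \<in> configs n q"
    unfolding x_def
  proof (rule restrict_in_configs)
    fix i assume i: "i \<in> {1..n}"
    show "h i < q"
    proof (cases "\<exists>u\<in>U. i \<in> ?N u")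
      case True
      then show ?thesis using h z(1) configs_less i by metis
    next
      case False
      then show ?thesis using q by (simp add: h_def)
    qed
  qed
  have "x u \<noteq> f x u" if u: "u \<in> U" for u
  proof -
    have nbh: "?N u = insert u (in_nbh D u)"
      using u U_sub verts by (intro in_nbh_add_loops) auto
    \<comment> \<open>Because of the loop, \<open>u\<close> itself lies in \<open>?N u\<close>: so
      \<open>x\<close> and \<open>z u\<close> agree at \<open>u\<close> as well as having the same
      image there.\<close>
    have agree: "x w = z u w" if "w \<in> ?N u" for w
    proof -
      have "w \<in> {1..n}" using that u U_sub arc_verts(1) unfolding nbh by (auto simp only: in_nbh_def)
      then show ?thesis using h[OF u that] by (simp add: x_def)
    qed
    have "f x u = f (z u) u"
      using u U_sub z(1) x agree by (intro networks_local[OF f]) auto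
    then show ?thesis using z(2)[OF u] agree[of u] nbh by simp
  qed
  then have "card U \<le> hamming_dist n x (f x)"
    unfolding hamming_dist_def using U_sub by (intro card_mono) auto
  then show ?thesis using stability_le[OF x, of f] U(2) by linarith
qed

section \<open>A network attaining the upper bound\<close>

lemma stable_network:
  assumes q: "q \<ge> 2" "q \<ge> n - card (sources D)"
  obtains f where "f \<in> networks n (add_loops D) q"
    "\<And>x. x \<in> configs n q \<Longrightarrow> hamming_dist n x (f x) \<le> sigma D"
proof -
  \<comment> \<open>The bound \<open>q \<ge> n - card (sources D)\<close> provides enough states to
    serve as distinct colours of the non-sources.\<close>
  have "card ({1..n} - sources D) = n - card (sources D)"
    using verts by (subst card_Diff_subset) (auto simp: sources_def)
  then obtain c :: "nat \<Rightarrow> nat" where c: "c ` ({1..n} - sources D) \<subseteq> {0..<q}"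
      "inj_on c ({1..n} - sources D)"
    using card_le_inj[of "{1..n} - sources D" "{0..<q}"] q by auto
  define P where "P v x \<longleftrightarrow> v \<notin> sources D \<and> x v = c v \<and> (\<forall>w. (w, v) \<in> parcs D \<longrightarrow> x w = c v)" for v x
  \<comment> \<open>When \<open>P v x\<close> holds, \<open>x v\<close> is \<open>c v\<close>, so
    the new state only has to differ from \<open>c v\<close>; the cyclic successor does, as
    \<open>q \<ge> 2\<close>.\<close>
  define g where "g v x = (if P v x then Suc (c v) mod q else x v)" for v x
  have c_lt: "c v < q" if "v \<in> {1..n}" "v \<notin> sources D" for v
    using subsetD[OF c(1) imageI, of v] that by simp
  have Suc_mod_ne: "Suc a mod q \<noteq> a" if "a < q" for a
    using that q by (simp add: mod_Suc)
  have const: "restrict (\<lambda>_. a) {1..n} \<in> configs n q" if "a < q" for a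
    using that by (intro restrict_in_configs) auto
  let ?f = "\<lambda>x\<in>configs n q. \<lambda>v\<in>{1..n}. g v x"
  have "?f \<in> networks n (add_loops D) q"
  proof (rule network_add_loops)
    show "g v x < q" if "v \<in> {1..n}" "x \<in> configs n q" for v x
      using configs_less[OF that(2,1)] q by (auto simp: g_def)
    show "g v x = g v y"
      if "v \<in> {1..n}" "x v = y v" "\<And>w. (w, v) \<in> parcs D \<Longrightarrow> x w = y w" for v x y
    proof -
      have "P v x \<longleftrightarrow> P v y" using that by (auto simp: P_def)
      then show ?thesis using that(2) by (simp add: g_def)
    qed
    show "\<exists>x\<in>configs n q. \<exists>a<q. g v (x(v := a)) \<noteq> g v x" if v: "v \<in> {1..n}" for v
    proof -
      \<comment> \<open>A constant configuration avoiding the colour of \<open>v\<close>: an in-neighbour other than \<open>v\<close> then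
        blocks the rule at \<open>v\<close> whatever the state of \<open>v\<close>.\<close>
      define b where "b = (if c v = 0 then 1 else 0 :: nat)"
      define x where "x = restrict (\<lambda>_. b) {1..n}"
      have b: "b < q" "b \<noteq> c v" using q by (auto simp: b_def)
      have x: "x \<in> configs n q" unfolding x_def by (rule const) (rule b)
      have "\<not> P v (x(v := a))" for a
      proof (cases "v \<in> sources D")
        case True
        then show ?thesis by (simp add: P_def)
      next
        case False
        then obtain w where w: "(w, v) \<in> parcs D" using not_source_in_neighbour v by blast
        then have "(x(v := a)) w \<noteq> c v" using arc_verts[OF w] b by (simp add: x_def)
        then show ?thesis using w unfolding P_def by blast
      qed
      then have upd: "g v (x(v := a)) = a" for a by (simp add: g_def)
      have "g v x = b" using upd[of b] v by (simp add: x_def fun_upd_idem)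
      \<comment> \<open>\<open>1 - b\<close> is the other one of the states 0 and 1; while the rule
        is blocked, \<open>g\<close> copies the state of \<open>v\<close>, so the two are told
        apart.\<close>
      moreover have "1 - b < q" "1 - b \<noteq> b" using q by (auto simp: b_def)
      ultimately show ?thesis using x upd by metis
    qed
    show "\<exists>x\<in>configs n q. \<exists>a<q. g v (x(u := a)) \<noteq> g v x" if uv: "(u, v) \<in> parcs D" for u v
    proof -
      note av = arc_verts[OF uv]
      have ns: "v \<notin> sources D" using uv by (auto simp: sources_def in_nbh_def)
      \<comment> \<open>In this configuration the rule fires at \<open>v\<close>. Recolouring
        \<open>u\<close> stops it, and since \<open>u \<noteq> v\<close> the vertex \<open>v\<close>
        then keeps \<open>c v\<close>.\<close>
      define x where "x = restrict (\<lambda>_. c v) {1..n}"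
      have x: "x \<in> configs n q" unfolding x_def by (rule const) (rule c_lt[OF av(2) ns])
      have "P v x" using ns av(2) arc_verts by (auto simp: P_def x_def)
      then have 1: "g v x = Suc (c v) mod q" by (simp add: g_def)
      have ne: "Suc (c v) mod q \<noteq> c v" by (rule Suc_mod_ne) (rule c_lt[OF av(2) ns])
      then have "\<not> P v (x(u := Suc (c v) mod q))" using uv by (auto simp: P_def)
      then have "g v (x(u := Suc (c v) mod q)) = c v" using av by (simp add: g_def x_def)
      then show ?thesis using x 1 ne q by (intro bexI[of _ x] exI[of _ "Suc (c v) mod q"]) auto
    qed
  qed
  moreover have "hamming_dist n x (?f x) \<le> sigma D" if x: "x \<in> configs n q" for x
  proof -
    let ?U = "{v \<in> {1..n}. x v \<noteq> ?f x v}"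
    have P: "P v x" if "v \<in> ?U" for v
      using that x by (auto simp: g_def split: if_splits)
    have val: "x w = c v" if "v \<in> ?U" "w \<in> in_nbh (add_loops D) v" for v w
      using P[OF that(1)] that(2) by (auto simp: P_def in_nbh_def add_loops_arc_iff)
    have non_source: "v \<notin> sources D" if "v \<in> ?U" for v
      using P[OF that] by (simp add: P_def)
    have "packing D ?U"
      unfolding packing_def
    proof (intro conjI ballI impI)
      show "?U \<subseteq> pverts D - sources D" using non_source verts by blast
      fix u v assume uv: "u \<in> ?U" "v \<in> ?U" "u \<noteq> v"
      \<comment> \<open>A common in-neighbour would have to be in state \<open>c u\<close> and in
        state \<open>c v\<close>.\<close>
      then have "c u \<noteq> c v" using c(2) non_source by (auto dest: inj_onD)
      then show "in_nbh (add_loops D) u \<inter> in_nbh (add_loops D) v = {}"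
        using val[OF uv(1)] val[OF uv(2)] by force
    qed
    then show ?thesis
      unfolding hamming_dist_def using verts by (intro card_packing_le_sigma) auto
  qed
  ultimately show ?thesis using that by blast
qed

lemma max_stability_add_loops:
  assumes "q \<ge> 2" "q \<ge> n - card (sources D)"
  shows "max_stability n (add_loops D) q = n - sigma D"
proof -
  obtain f where f: "f \<in> networks n (add_loops D) q"
    "\<And>x. x \<in> configs n q \<Longrightarrow> hamming_dist n x (f x) \<le> sigma D"
    using stable_network[OF assms] by blast
  have q: "q > 0" using assms by simp
  have "stability n q f = n - sigma D"
    using stability_upper_bound[OF f(1) q] stability_ge[OF q f(2)] by (simp add: order_antisym)
  then show ?thesis
    unfolding max_stability_def
    using finite_networks f(1) stability_upper_bound q by (intro Max_eqI) force+
qed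

section \<open>A network moving every coordinate, and maximal instability\<close>

lemma fixed_point_free_network:
  assumes q: "q \<ge> 3"
  obtains f where "f \<in> networks n (add_loops D) q"
    "\<And>x v. x \<in> configs n q \<Longrightarrow> v \<in> {1..n} \<Longrightarrow> f x v \<noteq> x v"
proof -
  define k :: "nat \<Rightarrow> (nat \<Rightarrow> nat) \<Rightarrow> nat"
    \<comment> \<open>For \<open>q \<ge> 3\<close> the increments 1 and 2 are distinct and nonzero
      modulo \<open>q\<close>, so every vertex always moves. At a source the condition is vacuous
      and the increment is constantly 2.\<close>
    where "k v x = (if \<forall>w. (w, v) \<in> parcs D \<longrightarrow> x w = 0 then 2 else 1)" for v x
  define g where "g v x = (x v + k v x) mod q" for v x
  define x0 :: "nat \<Rightarrow> nat" where "x0 = restrict (\<lambda>_. 0) {1..n}"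
  have x0: "x0 \<in> configs n q" unfolding x0_def using q by (intro restrict_in_configs) auto
  have x0_0: "x0 v = 0" if "v \<in> {1..n}" for v using that by (simp add: x0_def)
  have k0: "k v x0 = 2" for v using arc_verts by (simp add: k_def x0_def)
  let ?f = "\<lambda>x\<in>configs n q. \<lambda>v\<in>{1..n}. g v x"
  have "?f \<in> networks n (add_loops D) q"
  proof (rule network_add_loops)
    show "g v x < q" for v x using q by (simp add: g_def)
    show "g v x = g v y"
      if "v \<in> {1..n}" "x v = y v" "\<And>w. (w, v) \<in> parcs D \<Longrightarrow> x w = y w" for v x y
      using that by (simp add: g_def k_def)
    show "\<exists>x\<in>configs n q. \<exists>a<q. g v (x(v := a)) \<noteq> g v x" if v: "v \<in> {1..n}" for v
    proof -
      \<comment> \<open>\<open>v\<close> is not its own in-neighbour in \<open>D\<close>, so the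
        increment stays 2 and only the summand \<open>x v\<close> changes.\<close>
      have "k v (x0(v := 1)) = k v x0"
        using arc_verts by (auto simp: k_def)
      then have "g v (x0(v := 1)) \<noteq> g v x0"
        using q k0 x0_0[OF v] by (simp add: g_def mod_if)
      then show ?thesis using x0 q by (intro bexI[of _ x0] exI[of _ 1]) auto
    qed
    show "\<exists>x\<in>configs n q. \<exists>a<q. g v (x(u := a)) \<noteq> g v x" if uv: "(u, v) \<in> parcs D" for u v
    proof -
      \<comment> \<open>Now \<open>x v\<close> stays 0 and the increment drops from 2 to 1.\<close>
      have "k v (x0(u := 1)) = 1" using uv by (auto simp: k_def)
      then have "g v (x0(u := 1)) \<noteq> g v x0"
        using q k0 x0_0 arc_verts[OF uv] by (simp add: g_def)
      then show ?thesis using x0 q by (intro bexI[of _ x0] exI[of _ 1]) auto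
    qed
  qed
  moreover have "?f x v \<noteq> x v" if "x \<in> configs n q" "v \<in> {1..n}" for x v
    using configs_less[OF that] that q by (auto simp: g_def k_def mod_if)
  ultimately show ?thesis using that by blast
qed

lemma max_instability_add_loops:
  assumes "q \<ge> 3"
  shows "max_instability n (add_loops D) q = n"
proof -
  have q: "q > 0" using assms by simp
  obtain f where f: "f \<in> networks n (add_loops D) q"
    "\<And>x v. x \<in> configs n q \<Longrightarrow> v \<in> {1..n} \<Longrightarrow> f x v \<noteq> x v"
    using fixed_point_free_network[OF assms] by blast
  have "instability n q f = n" by (rule instability_eq) (use q f(2) in auto)
  then show ?thesis
    unfolding max_instability_def
    using finite_networks f(1) instability_le[OF q] by (intro Max_eqI) force+
qed

end

theorem proposition3p1:
  fixes n :: nat and D :: "nat pair_pre_digraph"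
  assumes "n \<ge> 1"
    and "pverts D = {1..n}"
    and "pair_loopfree_digraph D"
  shows "(\<forall>q::nat. q \<ge> 2 \<longrightarrow> q \<ge> n - card (sources D) \<longrightarrow>
            max_stability n (add_loops D) q = n - sigma D)
       \<and> (\<forall>q::nat. q \<ge> 3 \<longrightarrow> max_instability n (add_loops D) q = n)"
  using max_stability_add_loops[OF assms(2,3)] max_instability_add_loops[OF assms(2,3)] by blast

end
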